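(* Let $X$ be a smooth manifold (without boundary), $Y$ a Polish space, $\mu\in\mathcal{P}(X)$, $\nu\in\mathcal{P}(Y)$, and let $c\colon X\times Y\to\mathbb{R}_+$ be continuous such that $c(\cdot,y)$ is differentiable and locally Lipschitz locally uniformly in $y\in Y$, with $T_c(\mu,\nu)<\infty$. If $\Sigma_\pi\subset\partial\,\mathrm{supp}\,\mu$ for an optimal plan $\pi\in\mathcal{C}(\mu,\nu)$, and if $M=\mathrm{int}(\mathrm{supp}\,\mu)$ is connected such that $\mathrm{cl}(M)=\mathrm{supp}\,\mu$ and $\mu(M)=1$, then the Kantorovich potentials $S_c(\mu,\nu)$ are unique.
   Context: $X$ is also Polish as a topological space. $\mathcal{P}(X)$ is the set of Borel probability measures; $\mathcal{C}(\mu,\nu)$ is the set of probability measures on $X\times Y$ with marginals $\mu,\nu$; $T_c(\mu,\nu)=\inf_{\pi\in\mathcal{C}(\mu,\nu)}\int c\,\mathrm{d}\pi$, and $\pi$ is optimal if it attains the infimum. $\mathrm{supp}$ is the smallest closed set of full measure; $\mathrm{int}$ and $\mathrm{cl}$ denote interior and closure in $X$, $\partial A=\mathrm{cl}(A)\setminus\mathrm{int}(A)$; $p_X\colon X\times Y\to X$ is the projection. Kantorovich potentials: for $g\colon Y\to\mathbb{R}\cup\{-\infty\}$ set $g^c(x)=\inf_{y\in Y}c(x,y)-g(y)$, and for $f\colon X\to\mathbb{R}\cup\{-\infty\}$ set $f^c(y)=\inf_{x\in X}c(x,y)-f(x)$. A function $f\colon X\to\mathbb{R}\cup\{-\infty\}$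 is $c$-concave on $X$ if $f=g^c$ for some $g\colon Y\to\mathbb{R}\cup\{-\infty\}$ and $f\not\equiv-\infty$. $S_c(\mu,\nu)$ is the set of $c$-concave $f$ with $T_c(\mu,\nu)=\int c\,\mathrm{d}\pi=\int(f(x)+f^c(y))\,\mathrm{d}\pi(x,y)$ for an optimal plan $\pi$ (equivalently, every optimal plan). They are called unique if $f_1-f_2$ is $\mu$-almost surely constant for all $f_1,f_2\in S_c(\mu,\nu)$. Induced regularity: a plan $\pi\in\mathcal{C}(\mu,\nu)$ induces regularity on a relatively open set $U\subset\mathrm{supp}\,\mu$ if there is a compact $K\subset\mathrm{supp}\,\nu$ with $p_X(\mathrm{supp}\,\pi)\cap U=p_X\big(\mathrm{supp}\,\pi\cap(U\times K)\big)$. It induces regularity at $x\in\mathrm{supp}\,\mu$ if it induces regularity on some relatively open neighborhood $U\subset\mathrm{supp}\,\mu$ of $x$. $\Sigma_\pi=\{x\in\mathrm{supp}\,\mu\mid\pi\text{ does not induce regularity at }x\}$. A function on a smooth manifold is locally Lipschitz if it is locally Lipschitz in every chart of an atlas. A family $(f_y)_{y\in Y}$ is locally Lipschitz uniformly in $y$ if each $f_y$ is locally Lipschitz with neighborhoods and Lipschitz constants that do not depend on $y$; it is locally Lipschitz locally uniformly in $y$ if for each compact $K\subset Y$ the functions $f_y$ are locally Lipschitz uniformly in $y\in K$. *)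

theory Defs
  imports "HOL-Probability.Probability"
begin

section \<open>Smooth manifolds\<close>

text \<open>On an open set of a finite-dimensional space this is membership in the class of k times
  continuously differentiable maps.\<close>

primrec Ck_on ::
    "nat \<Rightarrow> 'a::real_normed_vector set \<Rightarrow> ('a \<Rightarrow> 'b::real_normed_vector) \<Rightarrow> bool" where
  "Ck_on 0 S f \<longleftrightarrow> continuous_on S f"
| "Ck_on (Suc k) S f \<longleftrightarrow>
     (\<forall>x\<in>S. f differentiable (at x)) \<and> (\<forall>v. Ck_on k S (\<lambda>x. frechet_derivative f (at x) v))"

definition smooth_on ::
    "'a::real_normed_vector set \<Rightarrow> ('a \<Rightarrow> 'b::real_normed_vector) \<Rightarrow> bool" where
  "smooth_on S f \<longleftrightarrow> (\<forall>k. Ck_on k S f)"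

text \<open>A chart is a pair of a domain \<open>U\<close> and a coordinate map \<open>\<phi>\<close> whose values outside \<open>U\<close> are
  irrelevant. The model space is a finite-dimensional real inner product space rather than
  an instance of class \<open>euclidean_space\<close>, because the latter would exclude dimension 0.
  The Hausdorff property and second countability of the manifold come from the type class of the
  points wherever the manifold is used (a Polish space).\<close>

type_synonym ('a, 'e) chart = "'a set \<times> ('a \<Rightarrow> 'e)"

definition is_chart :: "('a::topological_space, 'e::real_inner) chart \<Rightarrow> bool" where
  "is_chart = (\<lambda>(U, \<phi>). open U \<and> open (\<phi> ` U) \<and> homeomorphism U (\<phi> ` U) \<phi> (inv_into U \<phi>))"

definition smooth_atlas :: "('a::topological_space, 'e::real_inner) chart set \<Rightarrow> bool" where
  "smooth_atlas \<A> \<longleftrightarrow>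
     (\<exists>B::'e set. finite B \<and> span B = UNIV) \<and>
     (\<forall>C\<in>\<A>. is_chart C) \<and>
     (\<Union>(U, \<phi>)\<in>\<A>. U) = UNIV \<and>
     (\<forall>(U, \<phi>)\<in>\<A>. \<forall>(V, \<psi>)\<in>\<A>. smooth_on (\<phi> ` (U \<inter> V)) (\<psi> \<circ> inv_into U \<phi>))"

definition differentiable_in_charts ::
    "('a::topological_space, 'e::real_inner) chart set \<Rightarrow> ('a \<Rightarrow> real) \<Rightarrow> bool" where
  "differentiable_in_charts \<A> f \<longleftrightarrow>
     (\<forall>(U, \<phi>)\<in>\<A>. \<forall>x\<in>U. (f \<circ> inv_into U \<phi>) differentiable (at (\<phi> x)))"

definition locally_lipschitz_uniformly ::
    "('a::topological_space, 'e::real_inner) chart set \<Rightarrow> 'b set \<Rightarrow> ('b \<Rightarrow> 'a \<Rightarrow> real) \<Rightarrow> bool" where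
  "locally_lipschitz_uniformly \<A> K f \<longleftrightarrow>
     (\<forall>(U, \<phi>)\<in>\<A>. \<forall>x\<in>U. \<exists>N L. open N \<and> x \<in> N \<and> N \<subseteq> U \<and>
        (\<forall>y\<in>K. L-lipschitz_on (\<phi> ` N) (f y \<circ> inv_into U \<phi>)))"

definition locally_lipschitz_locally_uniformly ::
    "('a::topological_space, 'e::real_inner) chart set \<Rightarrow>
     ('b::topological_space \<Rightarrow> 'a \<Rightarrow> real) \<Rightarrow> bool" where
  "locally_lipschitz_locally_uniformly \<A> f \<longleftrightarrow>
     (\<forall>K. compact K \<longrightarrow> locally_lipschitz_uniformly \<A> K f)"

section \<open>Optimal transport\<close>

definition borel_probs :: "'a::topological_space measure set" where
  "borel_probs = {M. prob_space M \<and> sets M = sets borel}"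

definition supp :: "'a::topological_space measure \<Rightarrow> 'a set" where
  "supp M = \<Inter>{C. closed C \<and> emeasure M (- C) = 0}"

definition couplings ::
    "'a::topological_space measure \<Rightarrow> 'b::topological_space measure \<Rightarrow> ('a \<times> 'b) measure set" where
  "couplings \<mu> \<nu> = {\<pi> \<in> borel_probs. distr \<pi> borel fst = \<mu> \<and> distr \<pi> borel snd = \<nu>}"

definition transport_cost ::
    "('a::topological_space \<times> 'b::topological_space \<Rightarrow> real) \<Rightarrow> 'a measure \<Rightarrow> 'b measure \<Rightarrow> ennreal" where
  "transport_cost c \<mu> \<nu> = (INF \<pi>\<in>couplings \<mu> \<nu>. \<integral>\<^sup>+z. ennreal (c z) \<partial>\<pi>)"

definition optimal_plans ::
    "('a::topological_space \<times> 'b::topological_space \<Rightarrow> real) \<Rightarrow> 'a measure \<Rightarrow> 'b measure \<Rightarrow>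
     ('a \<times> 'b) measure set" where
  "optimal_plans c \<mu> \<nu> =
     {\<pi> \<in> couplings \<mu> \<nu>. (\<integral>\<^sup>+z. ennreal (c z) \<partial>\<pi>) = transport_cost c \<mu> \<nu>}"

subsection \<open>Kantorovich potentials\<close>

text \<open>Functions into the reals extended by \<open>-\<infinity>\<close> are \<open>ereal\<close>-valued functions that omit \<open>\<infinity>\<close>.\<close>

definition ctransform_Y :: "('a \<times> 'b \<Rightarrow> real) \<Rightarrow> ('b \<Rightarrow> ereal) \<Rightarrow> 'a \<Rightarrow> ereal" where
  "ctransform_Y c g x = (INF y. ereal (c (x, y)) - g y)"

definition ctransform_X :: "('a \<times> 'b \<Rightarrow> real) \<Rightarrow> ('a \<Rightarrow> ereal) \<Rightarrow> 'b \<Rightarrow> ereal" where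
  "ctransform_X c f y = (INF x. ereal (c (x, y)) - f x)"

definition c_concave :: "('a \<times> 'b \<Rightarrow> real) \<Rightarrow> ('a \<Rightarrow> ereal) \<Rightarrow> bool" where
  "c_concave c f \<longleftrightarrow>
     (\<forall>x. f x \<noteq> \<infinity>) \<and> (\<exists>x. f x \<noteq> -\<infinity>) \<and>
     (\<exists>g. (\<forall>y. g y \<noteq> \<infinity>) \<and> f = ctransform_Y c g)"

text \<open>Integral of an extended real function as the difference of the integrals of its positive and
  negative parts (\<open>e2ennreal\<close> sends negative numbers to 0). It is meaningful if one
  of the two is finite; below the integrand is at most \<open>c\<close>, so its positive part has integral at
  most the finite transport cost.\<close>

definition ereal_integral :: "'a measure \<Rightarrow> ('a \<Rightarrow> ereal) \<Rightarrow> ereal" where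
  "ereal_integral M h =
     enn2ereal (\<integral>\<^sup>+x. e2ennreal (h x) \<partial>M) - enn2ereal (\<integral>\<^sup>+x. e2ennreal (- h x) \<partial>M)"

definition kantorovich_potentials ::
    "('a::topological_space \<times> 'b::topological_space \<Rightarrow> real) \<Rightarrow> 'a measure \<Rightarrow> 'b measure \<Rightarrow>
     ('a \<Rightarrow> ereal) set" where
  "kantorovich_potentials c \<mu> \<nu> =
     {f. c_concave c f \<and>
         (\<exists>\<pi>\<in>optimal_plans c \<mu> \<nu>.
            ereal_integral \<pi> (\<lambda>(x, y). f x + ctransform_X c f y) = enn2ereal (transport_cost c \<mu> \<nu>))}"

text \<open>The constant is real: when the transport cost is finite, potentials are finite almost
  surely, and \<open>-\<infinity> - (-\<infinity>)\<close>, which is \<open>\<infinity>\<close> in type \<open>ereal\<close>, does not count as a constant.\<close>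

definition unique_potentials ::
    "('a::topological_space \<times> 'b::topological_space \<Rightarrow> real) \<Rightarrow> 'a measure \<Rightarrow> 'b measure \<Rightarrow> bool" where
  "unique_potentials c \<mu> \<nu> \<longleftrightarrow>
     (\<forall>f\<^sub>1\<in>kantorovich_potentials c \<mu> \<nu>. \<forall>f\<^sub>2\<in>kantorovich_potentials c \<mu> \<nu>.
        \<exists>a::real. AE x in \<mu>. f\<^sub>1 x - f\<^sub>2 x = ereal a)"

subsection \<open>Induced regularity\<close>

definition induces_regularity_on ::
    "'a::topological_space measure \<Rightarrow> 'b::topological_space measure \<Rightarrow> ('a \<times> 'b) measure \<Rightarrow>
     'a set \<Rightarrow> bool" where
  "induces_regularity_on \<mu> \<nu> \<pi> U \<longleftrightarrow>
     openin (top_of_set (supp \<mu>)) U \<and>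
     (\<exists>K. compact K \<and> K \<subseteq> supp \<nu> \<and> fst ` supp \<pi> \<inter> U = fst ` (supp \<pi> \<inter> (U \<times> K)))"

definition induces_regularity_at ::
    "'a::topological_space measure \<Rightarrow> 'b::topological_space measure \<Rightarrow> ('a \<times> 'b) measure \<Rightarrow>
     'a \<Rightarrow> bool" where
  "induces_regularity_at \<mu> \<nu> \<pi> x \<longleftrightarrow> (\<exists>U. x \<in> U \<and> induces_regularity_on \<mu> \<nu> \<pi> U)"

definition irregular_points ::
    "'a::topological_space measure \<Rightarrow> 'b::topological_space measure \<Rightarrow> ('a \<times> 'b) measure \<Rightarrow> 'a set" where
  "irregular_points \<mu> \<nu> \<pi> = {x \<in> supp \<mu>. \<not> induces_regularity_at \<mu> \<nu> \<pi> x}"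

end

theory Submission
  imports Defs
begin

text \<open>A potential \<open>f\<close> satisfies \<open>f(x) + f\<^sup>c(y) = c(x, y)\<close> on the support of every optimal plan, so
  whenever \<open>(x, y)\<close> lies in \<open>supp \<pi>\<close> the function \<open>c(\<cdot>, y) - f\<^sup>c(y)\<close> touches \<open>f\<close> from above at \<open>x\<close>.
  Induced regularity and compactness make every interior point \<open>x\<close> of \<open>supp \<mu>\<close> such a contact point,
  with \<open>y\<close> in a compact set locally. Hence any two potentials are locally Lipschitz there and have,
  at every point, a common supergradient, the gradient of \<open>c(\<cdot>, y)\<close>. Along a segment in a chart, two
  continuous functions with a common supergradient differ by a constant; this is shown with Dini
  derivatives instead of Rademacher's theorem: at all but countably many points the upper right
  derivative of either function equals the supergradient. Connectedness makes the constant global.\<close>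

section \<open>Real functions with a common supergradient\<close>

text \<open>Each such point is the unique strict maximiser of \<open>g\<close> over some interval
  with rational endpoints, so a pair of rationals determines at most one of them.\<close>

lemma countable_strict_local_maxima:
  fixes g :: "real \<Rightarrow> real"
  shows "countable {t. \<exists>d>0. \<forall>s. s \<noteq> t \<and> \<bar>s - t\<bar> < d \<longrightarrow> g s < g t}"
proof -
  define P where "P = (\<lambda>(q1, q2). {t \<in> {real_of_rat q1<..<real_of_rat q2}.
    \<forall>s\<in>{real_of_rat q1<..<real_of_rat q2}. s \<noteq> t \<longrightarrow> g s < g t})"
  have "countable (P z)" for z
  proof -
    have "s = t" if "s \<in> P z" "t \<in> P z" for s t
      using that unfolding P_def by (fastforce split: prod.splits)
    then have "P z = {} \<or> (\<exists>t. P z = {t})" by blast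
    then show ?thesis by auto
  qed
  then have "countable (\<Union>z. P z)" by simp
  moreover have "{t. \<exists>d>0. \<forall>s. s \<noteq> t \<and> \<bar>s - t\<bar> < d \<longrightarrow> g s < g t} \<subseteq> (\<Union>z. P z)"
  proof safe
    fix t d :: real
    assume d: "d > 0" and m: "\<forall>s. s \<noteq> t \<and> \<bar>s - t\<bar> < d \<longrightarrow> g s < g t"
    obtain q1 where q1: "t - d < real_of_rat q1" "real_of_rat q1 < t"
      using d of_rat_dense[of "t - d" t] by auto
    obtain q2 where q2: "t < real_of_rat q2" "real_of_rat q2 < t + d"
      using d of_rat_dense[of t "t + d"] by auto
    have "t \<in> P (q1, q2)"
      using q1 q2 m by (auto simp: P_def)
    then show "t \<in> (\<Union>z. P z)" by blast
  qed
  ultimately show ?thesis by (rule countable_subset[rotated])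
qed

text \<open>If \<open>f1 - f2\<close> dropped from \<open>a\<close> to \<open>b\<close>, so would
  \<open>h\<close>, its sum with a small positive slope \<open>e\<close>. At the last point
  \<open>t\<close> where \<open>h\<close> takes a level between \<open>h b\<close> and
  \<open>h a\<close>, the function \<open>f1\<close> grows to the right slower than
  \<open>f2\<close> by the rate \<open>e\<close>, hence with slope clearly below the common
  supergradient \<open>p\<close>, while its secants to the left have slope almost \<open>p\<close>
  or more. So \<open>f1\<close> has a concave kink at \<open>t\<close>. There are uncountably many
  levels but only countably many kinks.\<close>

lemma diff_le_of_common_supergradient:
  fixes f1 f2 :: "real \<Rightarrow> real"
  assumes "a \<le> b" and cont: "continuous_on {a..b} f1" "continuous_on {a..b} f2"
    and touch: "\<And>t. t \<in> {a<..<b} \<Longrightarrow> \<exists>p. \<forall>e>0. \<exists>d>0. \<forall>s. \<bar>s - t\<bar> < d \<longrightarrow>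
      f1 s - f1 t \<le> p * (s - t) + e * \<bar>s - t\<bar> \<and> f2 s - f2 t \<le> p * (s - t) + e * \<bar>s - t\<bar>"
  shows "f1 a - f2 a \<le> f1 b - f2 b"
proof (rule ccontr)
  assume neg: "\<not> ?thesis"
  then have "a < b" using assms(1) by (cases "a = b") auto
  \<comment> \<open>Half the average rate of decrease: adding the slope \<open>e\<close> gives back
    only half of the drop, so \<open>h b < h a\<close> survives.\<close>
  define e where "e = ((f1 a - f2 a) - (f1 b - f2 b)) / 2 / (b - a)"
  have "e > 0" using neg \<open>a < b\<close> by (simp add: e_def)
  define h where "h = (\<lambda>t. f1 t - f2 t + e * (t - a))"
  have "e * (b - a) = ((f1 a - f2 a) - (f1 b - f2 b)) / 2" using \<open>a < b\<close>
    unfolding e_def by (subst nonzero_eq_divide_eq[symmetric]) auto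
  then have hab: "h b < h a" using neg by (simp add: h_def)
  have ch: "continuous_on {a..b} h" unfolding h_def by (intro continuous_intros cont)
  \<comment> \<open>The kinks of \<open>f1\<close>: points that become strict local maxima after a
    rational slope is subtracted. Their \<open>h\<close>-values form a countable set, so some level
    \<open>r\<close> avoids them.\<close>
  define C where "C = (\<Union>q. {t. \<exists>d>0. \<forall>s. s \<noteq> t \<and> \<bar>s - t\<bar> < d \<longrightarrow>
    f1 s - real_of_rat q * s < f1 t - real_of_rat q * t})"
  have "countable C" unfolding C_def by (intro countable_UN countable_strict_local_maxima) auto
  then have "countable (h ` C)" by simp
  moreover have "uncountable {h b<..<h a}" using hab by (simp add: uncountable_open_interval)
  ultimately obtain r where r: "h b < r" "r < h a" "r \<notin> h ` C"
    by (metis countable_subset subsetI greaterThanLessThan_iff)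
  \<comment> \<open>The maximum \<open>t\<close> of \<open>R\<close> is the last crossing of the
    level \<open>r\<close>. Since \<open>h b < r\<close>, the intermediate value theorem keeps
    \<open>h\<close> below \<open>r\<close> to the right of it.\<close>
  define R where "R = {t \<in> {a..b}. h t = r}"
  have "R \<noteq> {}"
    using IVT2'[of h b r a] r ch \<open>a < b\<close> by (auto simp: R_def)
  moreover have "compact R"
  proof -
    have "closed R" unfolding R_def
      using continuous_closed_preimage_constant[OF ch, of r] by simp
    moreover have "R \<subseteq> {a..b}" by (auto simp: R_def)
    ultimately show ?thesis by (metis compact_Icc closed_Int_compact inf.absorb1)
  qed
  ultimately obtain t where t: "t \<in> R" and tmax: "\<And>s. s \<in> R \<Longrightarrow> s \<le> t"
    using compact_attains_sup[of R] by auto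
  have ht: "h t = r" and tab: "t \<in> {a<..<b}" 
    using t r unfolding R_def by (auto simp: less_le)
  have right: "h s < r" if s: "t < s" "s \<le> b" for s
  proof (rule ccontr)
    assume "\<not> h s < r"
    then have "r \<le> h s" by simp
    moreover have "continuous_on {s..b} h"
      by (rule continuous_on_subset[OF ch]) (use s tab in auto)
    ultimately obtain u where "s \<le> u" "u \<le> b" "h u = r"
      using IVT2'[of h b r s] r(1) s(2) by auto
    then have "u \<in> R" using s tab by (auto simp: R_def)
    then show False using tmax[of u] \<open>s \<le> u\<close> s(1) by simp
  qed
  have "t \<notin> C" using r ht by auto
  from touch[OF tab] obtain p where p: "\<And>e. e > 0 \<Longrightarrow> \<exists>d>0. \<forall>s. \<bar>s - t\<bar> < d \<longrightarrow>
      f1 s - f1 t \<le> p * (s - t) + e * \<bar>s - t\<bar> \<and> f2 s - f2 t \<le> p * (s - t) + e * \<bar>s - t\<bar>"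
    by blast
  \<comment> \<open>A rational slope that separates the two sides: close to \<open>t\<close>,
    secants of \<open>f1\<close> to the left have slope at least \<open>(p + q) / 2 > q\<close>,
    those to the right have slope below \<open>p - 2 * e / 3 < q\<close>.\<close>
  obtain q where q: "p - e/3 < real_of_rat q" "real_of_rat q < p"
    using of_rat_dense[of "p - e/3" p] \<open>e > 0\<close> by auto
  obtain d1 where d1: "d1 > 0" "\<And>s. \<bar>s - t\<bar> < d1 \<Longrightarrow>
      f1 s - f1 t \<le> p * (s - t) + (p - real_of_rat q) / 2 * \<bar>s - t\<bar>"
    using p[of "(p - real_of_rat q) / 2"] q by auto
  obtain d2 where d2: "d2 > 0" "\<And>s. \<bar>s - t\<bar> < d2 \<Longrightarrow>
      f2 s - f2 t \<le> p * (s - t) + e / 3 * \<bar>s - t\<bar>"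
    using p[of "e / 3"] \<open>e > 0\<close> by auto
  \<comment> \<open>The bound \<open>b - t\<close> keeps \<open>s \<le> b\<close>, so that
    \<open>right\<close> applies.\<close>
  define d where "d = min (min d1 d2) (b - t)"
  have d: "d > 0" using d1 d2 tab by (auto simp: d_def)
  have "f1 s - real_of_rat q * s < f1 t - real_of_rat q * t" if s: "s \<noteq> t" "\<bar>s - t\<bar> < d" for s
  proof (cases "s < t")
    case True
    have "f1 s - f1 t \<le> p * (s - t) + (p - real_of_rat q) / 2 * \<bar>s - t\<bar>"
      using d1 s by (auto simp: d_def)
    also have "\<dots> = (p + real_of_rat q) / 2 * (s - t)"
      using True by (simp add: field_simps)
    also have "\<dots> < real_of_rat q * (s - t)"
      using q True by (intro mult_strict_right_mono_neg) auto
    finally show ?thesis by (simp add: algebra_simps)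
  next
    case False
    then have st: "t < s" "s \<le> b" using s by (auto simp: d_def)
    have "f2 s - f2 t \<le> p * (s - t) + e / 3 * (s - t)"
      using d2(2)[of s] s st by (auto simp: d_def)
    moreover have "h s < h t" using right[OF st] ht by simp
    ultimately have "f1 s - f1 t < p * (s - t) + e / 3 * (s - t) - e * (s - t)"
      unfolding h_def right_diff_distrib[of e] by linarith
    also have "\<dots> = (p - 2 * e / 3) * (s - t)"
      by (simp add: field_simps)
    also have "\<dots> \<le> real_of_rat q * (s - t)"
      using q st \<open>e > 0\<close> by (intro mult_right_mono) auto
    finally show ?thesis by (simp add: algebra_simps)
  qed
  then have "t \<in> C" using d unfolding C_def by blast
  then show False using \<open>t \<notin> C\<close> by simp
qed

section \<open>Supports of measures and couplings\<close>

text \<open>The complement of the support is a union of possibly uncountably many open null sets;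
  the Lindelof property leaves countably many.\<close>

lemma emeasure_Compl_supp:
  fixes M :: "'a::second_countable_topology measure"
  assumes "sets M = sets borel"
  shows "emeasure M (- supp M) = 0"
proof -
  define F where "F = {C::'a set. closed C \<and> emeasure M (- C) = 0}"
  obtain G where G: "G \<subseteq> uminus ` F" "countable G" "\<Union>G = \<Union>(uminus ` F)"
    using Lindelof[of "uminus ` F"] by (auto simp: F_def)
  have "(\<Union>G) \<in> null_sets M"
  proof (rule null_sets_UN'[of G "\<lambda>x. x", simplified])
    show "N \<in> null_sets M" if "N \<in> G" for N
      using G that assms unfolding F_def null_sets_def by auto
  qed fact
  moreover have "- supp M = \<Union>G" using G by (auto simp: supp_def F_def)
  ultimately show ?thesis by auto
qed

lemma closed_supp: "closed (supp M)"
  unfolding supp_def by auto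

lemma supp_subset: "closed C \<Longrightarrow> emeasure M (- C) = 0 \<Longrightarrow> supp M \<subseteq> C"
  unfolding supp_def by auto

lemma couplingsD:
  assumes "\<pi> \<in> couplings \<mu> \<nu>"
  shows "prob_space \<pi>" "sets \<pi> = sets borel" "space \<pi> = UNIV"
    "fst \<in> \<pi> \<rightarrow>\<^sub>M borel" "snd \<in> \<pi> \<rightarrow>\<^sub>M borel"
    "distr \<pi> borel fst = \<mu>" "distr \<pi> borel snd = \<nu>"
proof -
  show s: "sets \<pi> = sets borel" and "prob_space \<pi>"
    "distr \<pi> borel fst = \<mu>" "distr \<pi> borel snd = \<nu>"
    using assms by (auto simp: couplings_def borel_probs_def)
  show "space \<pi> = UNIV" using s by (metis sets_eq_imp_space_eq space_borel)
  show "fst \<in> \<pi> \<rightarrow>\<^sub>M borel" "snd \<in> \<pi> \<rightarrow>\<^sub>M borel"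
    by (subst measurable_cong_sets[OF s refl],
        rule borel_measurable_continuous_onI, intro continuous_intros)+
qed

text \<open>If the strip over \<open>W\<close> missed \<open>supp \<pi>\<close>, then
  \<open>W\<close> would be null for the marginal and \<open>- W\<close> a closed set of full
  measure without \<open>x\<close>. This gives density of the projection of
  \<open>supp \<pi>\<close> only, since that projection need not be closed.\<close>

lemma supp_coupling_meets:
  fixes \<mu> :: "'a::second_countable_topology measure" and \<nu> :: "'b::second_countable_topology measure"
  assumes "\<pi> \<in> couplings \<mu> \<nu>" "open W" "x \<in> W" "x \<in> supp \<mu>"
  obtains z where "z \<in> supp \<pi>" "fst z \<in> W"
proof (rule ccontr)
  assume c: "\<not> thesis"
  note p = couplingsD[OF assms(1)]
  have "emeasure \<mu> W = emeasure \<pi> (fst -` W \<inter> space \<pi>)"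
    unfolding p(6)[symmetric] using assms(2) by (intro emeasure_distr p) auto
  also have "\<dots> \<le> emeasure \<pi> (- supp \<pi>)"
    using c that closed_supp[of \<pi>] by (intro emeasure_mono) (auto simp: p(2))
  also have "\<dots> = 0" by (rule emeasure_Compl_supp[OF p(2)])
  finally have "supp \<mu> \<subseteq> - W" using assms(2) by (intro supp_subset) auto
  then show False using assms by auto
qed

section \<open>Potentials on the supports of optimal plans\<close>

text \<open>Upper semicontinuity of both c-transforms at once: the infimum is below \<open>a\<close>
  iff one member is, and each member is continuous or constantly infinite. This yields Borel
  measurability and, later, openness of the set where contact fails.\<close>

lemma open_INF_diff_less:
  fixes k :: "'a::topological_space \<Rightarrow> 'b \<Rightarrow> real" and g :: "'b \<Rightarrow> ereal"
  assumes "\<And>y. continuous_on UNIV (\<lambda>x. k x y)"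
  shows "open {x. (INF y. ereal (k x y) - g y) < a}"
proof -
  have "{x. (INF y. ereal (k x y) - g y) < a} = (\<Union>y. {x. ereal (k x y) - g y < a})"
    by (auto simp: INF_less_iff)
  moreover have "open {x. ereal (k x y) - g y < a}" for y
  proof (cases "g y")
    case (real r)
    have "continuous_on UNIV (\<lambda>x. ereal (k x y - r))"
      using assms by (intro continuous_intros)
    then have "open {x. ereal (k x y - r) < a}"
      by (intro open_Collect_less) auto
    then show ?thesis using real by simp
  qed (cases a; simp)+
  ultimately show ?thesis by (simp add: open_UN)
qed

definition clip :: "nat \<Rightarrow> ereal \<Rightarrow> real" where
  "clip n a = real_of_ereal (max (- ereal (real n)) (min (ereal (real n)) a))"

lemma clip_ereal [simp]: "clip n (ereal r) = max (- real n) (min (real n) r)"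
  by (simp add: clip_def ereal_min[symmetric] ereal_max[symmetric] del: ereal_min ereal_max)

lemma clip_MInfty [simp]: "clip n (- \<infinity>) = - real n"
  by (simp add: clip_def)

lemma clip_PInfty [simp]: "clip n \<infinity> = real n"
  by (simp add: clip_def max_def)

lemma abs_clip_le: "\<bar>clip n a\<bar> \<le> real n"
  by (cases a) auto

lemma borel_measurable_clip [measurable]: "clip n \<in> borel_measurable borel"
  unfolding clip_def[abs_def] by measurable

text \<open>Clipping never increases a nonnegative sum. It can raise a negative one, but at most to
  0, which is why \<open>r\<close> has to be nonnegative.\<close>

lemma clip_add_le:
  assumes "a + b \<le> ereal r" "0 \<le> r" 
  shows "clip n a + clip n b \<le> r"
  using assms by (cases a; cases b) auto

lemma tendsto_clip:
  assumes "\<bar>a\<bar> \<noteq> \<infinity>"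
  shows "(\<lambda>n. clip n a) \<longlonglongrightarrow> real_of_ereal a"
proof (rule tendsto_eventually)
  obtain r where r: "a = ereal r" using assms by (cases a) auto
  obtain N where "\<bar>r\<bar> \<le> real N" using real_arch_simple by blast
  then have "\<forall>n\<ge>N. clip n a = real_of_ereal a"
    by (auto simp: r)
  then show "\<forall>\<^sub>F n in sequentially. clip n a = real_of_ereal a"
    unfolding eventually_sequentially by blast
qed

text \<open>Finiteness of \<open>f\<close> at \<open>x\<^sub>0\<close> keeps the transform below
  \<open>\<infinity>\<close>. Only then may \<open>f x\<close> be moved across the inequality, since
  \<open>- \<infinity> + \<infinity>\<close> is \<open>\<infinity>\<close> in
  \<open>ereal\<close>.\<close>

lemma add_ctransform_X_le:
  assumes "f x \<noteq> \<infinity>" "f x\<^sub>0 \<noteq> - \<infinity>" "f x\<^sub>0 \<noteq> \<infinity>"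
  shows "ctransform_X c f y \<noteq> \<infinity>" "f x + ctransform_X c f y \<le> ereal (c (x, y))"
proof -
  have le: "ctransform_X c f y \<le> ereal (c (x, y)) - f x" for x
    unfolding ctransform_X_def by (rule INF_lower) simp
  show fin: "ctransform_X c f y \<noteq> \<infinity>"
    using le[of x\<^sub>0] assms(2,3) by (cases "f x\<^sub>0") auto
  show "f x + ctransform_X c f y \<le> ereal (c (x, y))"
    using le[of x] fin assms(1) by (cases "f x"; cases "ctransform_X c f y") auto
qed

text \<open>The positive part of \<open>H\<close> is at most \<open>k\<close>, so its integral
  \<open>P\<close> is at most the finite \<open>T\<close>. Then \<open>P - N = T\<close> forces
  \<open>P = T\<close> and \<open>N = 0\<close>: the negative part vanishes almost everywhere and
  the positive part equals \<open>k\<close>.\<close>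

lemma ereal_integral_eqD:
  assumes H: "H \<in> borel_measurable M" and k: "k \<in> borel_measurable M"
    and le: "\<And>z. H z \<le> ereal (k z)" and k0: "\<And>z. 0 \<le> k z"
    and fin: "(\<integral>\<^sup>+z. ennreal (k z) \<partial>M) < \<infinity>"
    and eq: "ereal_integral M H = enn2ereal (\<integral>\<^sup>+z. ennreal (k z) \<partial>M)"
  shows "AE z in M. H z = ereal (k z)"
proof -
  define T where "T = (\<integral>\<^sup>+z. ennreal (k z) \<partial>M)"
  define P where "P = (\<integral>\<^sup>+z. e2ennreal (H z) \<partial>M)"
  define N where "N = (\<integral>\<^sup>+z. e2ennreal (- H z) \<partial>M)"
  have pw: "e2ennreal (H z) \<le> ennreal (k z)" for z
    using e2ennreal_mono[OF le[of z]] by simp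
  have "P \<le> T" unfolding P_def T_def by (intro nn_integral_mono pw)
  moreover have "enn2ereal P - enn2ereal N = enn2ereal T"
    using eq by (simp add: ereal_integral_def P_def N_def T_def)
  moreover have "T \<noteq> \<infinity>" using fin by (simp add: T_def)
  ultimately have PN: "P = T" "N = 0"
    by (cases P; cases N; cases T;
        auto simp: enn2ereal_ennreal top_ennreal.rep_eq zero_ennreal.rep_eq)+
  have m: "(\<lambda>z. e2ennreal (H z)) \<in> borel_measurable M" "(\<lambda>z. e2ennreal (- H z)) \<in> borel_measurable M"
    using H by measurable
  have "AE z in M. e2ennreal (- H z) = 0"
    using PN(2) m by (simp add: N_def nn_integral_0_iff_AE)
  moreover have "(\<integral>\<^sup>+z. (ennreal (k z) - e2ennreal (H z)) \<partial>M) = T - P"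
    unfolding T_def P_def using m k pw fin PN
    by (intro nn_integral_diff) (auto simp: P_def T_def)
  then have "(\<integral>\<^sup>+z. (ennreal (k z) - e2ennreal (H z)) \<partial>M) = 0"
    using PN fin by (simp add: T_def)
  then have "AE z in M. ennreal (k z) - e2ennreal (H z) = 0"
    using m k by (subst (asm) nn_integral_0_iff_AE) auto
  ultimately show ?thesis
  proof eventually_elim
    case (elim z)
    have "0 \<le> H z"
      using elim(1) by (cases "H z") (auto simp: e2ennreal_ereal ennreal_eq_0_iff)
    moreover have "ennreal (k z) \<le> e2ennreal (H z)"
      using elim(2) by (metis diff_eq_0_iff_ennreal ennreal_less_top pw leI less_imp_neq top.not_eq_extremum infinity_ennreal_def)
    ultimately have "ereal (k z) \<le> H z"
      using le[of z] k0[of z] by (cases "H z") (auto simp: e2ennreal_ereal)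
    then show ?case using le[of z] by auto
  qed
qed

text \<open>The functions \<open>f\<close> and \<open>g\<close> need not be integrable separately; clipping them makes the
  integral of \<open>f \<oplus> g\<close> depend on the marginals only.\<close>

lemma AE_equality_couplings:
  assumes \<pi>: "\<pi> \<in> couplings \<mu> \<nu>" and \<pi>': "\<pi>' \<in> couplings \<mu> \<nu>"
    and k: "k \<in> borel_measurable borel" and k0: "\<And>z. 0 \<le> k z"
    and fin: "(\<integral>\<^sup>+z. ennreal (k z) \<partial>\<pi>) < \<infinity>"
    and eq: "(\<integral>\<^sup>+z. ennreal (k z) \<partial>\<pi>) = (\<integral>\<^sup>+z. ennreal (k z) \<partial>\<pi>')"
    and f: "f \<in> borel_measurable borel" and g: "g \<in> borel_measurable borel"
    and le: "\<And>x y. f x + g y \<le> ereal (k (x, y))"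
    and AE': "AE z in \<pi>'. f (fst z) + g (snd z) = ereal (k z)"
  shows "AE z in \<pi>. f (fst z) + g (snd z) = ereal (k z)"
proof -
  define u where "u = (\<lambda>n z. clip n (f (fst z)) + clip n (g (snd z)))"
  note p = couplingsD[OF \<pi>] and p' = couplingsD[OF \<pi>']
  interpret P: prob_space \<pi> by (rule p)
  interpret P': prob_space \<pi>' by (rule p')
  have km: "k \<in> borel_measurable \<pi>" "k \<in> borel_measurable \<pi>'"
    using k p(2) p'(2) by (auto cong: measurable_cong_sets)
  have meas: "(\<lambda>z. clip n (f (fst z))) \<in> borel_measurable M"
    "(\<lambda>z. clip n (g (snd z))) \<in> borel_measurable M" "u n \<in> borel_measurable M"
    if "M \<in> couplings \<mu> \<nu>" for M n
    unfolding u_def using couplingsD(4,5)[OF that] f g by measurable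
  have intk: "integrable \<pi> k" "integrable \<pi>' k"
    using km k0 fin eq by (auto intro!: integrableI_nonneg)
  have kk: "integral\<^sup>L \<pi> k = integral\<^sup>L \<pi>' k"
    using km k0 eq by (simp add: integral_eq_nn_integral)
  have intc: "integrable M (\<lambda>z. clip n (f (fst z)))" "integrable M (\<lambda>z. clip n (g (snd z)))"
    and uval: "integral\<^sup>L M (u n) = (\<integral>x. clip n (f x) \<partial>\<mu>) + (\<integral>y. clip n (g y) \<partial>\<nu>)"
    if M: "M \<in> couplings \<mu> \<nu>" for M n
  proof -
    note q = couplingsD[OF M]
    interpret Q: prob_space M by (rule q)
    show i: "integrable M (\<lambda>z. clip n (f (fst z)))" "integrable M (\<lambda>z. clip n (g (snd z)))"
      by (rule Q.integrable_const_bound[where B="real n"]; use meas[OF M] abs_clip_le in auto)+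
    have "(\<integral>x. clip n (f x) \<partial>distr M borel fst) = (\<integral>z. clip n (f (fst z)) \<partial>M)"
      using q f by (intro integral_distr) auto
    moreover have "(\<integral>x. clip n (g x) \<partial>distr M borel snd) = (\<integral>z. clip n (g (snd z)) \<partial>M)"
      using q g by (intro integral_distr) auto
    ultimately show "integral\<^sup>L M (u n) = (\<integral>x. clip n (f x) \<partial>\<mu>) + (\<integral>y. clip n (g y) \<partial>\<nu>)"
      using i q by (simp add: u_def)
  qed
  have intu: "integrable M (u n)" if "M \<in> couplings \<mu> \<nu>" for M n
    unfolding u_def using intc[OF that] by simp
  have ule: "u n z \<le> k z" for n z
    unfolding u_def using le[of "fst z" "snd z"] k0[of z] by (intro clip_add_le) auto
  have fing: "AE z in \<pi>'. \<bar>f (fst z)\<bar> \<noteq> \<infinity> \<and> \<bar>g (snd z)\<bar> \<noteq> \<infinity>"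
    using AE'
  proof eventually_elim
    case (elim z)
    then show ?case by (cases "f (fst z)"; cases "g (snd z)") auto
  qed
  \<comment> \<open>Finiteness of \<open>f\<close> and of \<open>g\<close> separately is a statement
    about one marginal each, so it passes from \<open>\<pi>'\<close> to
    \<open>\<pi>\<close>.\<close>
  have "AE z in \<pi>'. \<bar>f (fst z)\<bar> \<noteq> \<infinity>" using fing by auto
  then have "AE x in \<mu>. \<bar>f x\<bar> \<noteq> \<infinity>"
    using p'(4) f unfolding p'(6)[symmetric] by (subst AE_distr_iff) auto
  then have f1: "AE z in \<pi>. \<bar>f (fst z)\<bar> \<noteq> \<infinity>"
    using p(4) f unfolding p(6)[symmetric] by (subst (asm) AE_distr_iff) auto
  have "AE z in \<pi>'. \<bar>g (snd z)\<bar> \<noteq> \<infinity>" using fing by auto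
  then have "AE x in \<nu>. \<bar>g x\<bar> \<noteq> \<infinity>"
    using p'(5) g unfolding p'(7)[symmetric] by (subst AE_distr_iff) auto
  then have g1: "AE z in \<pi>. \<bar>g (snd z)\<bar> \<noteq> \<infinity>"
    using p(5) g unfolding p(7)[symmetric] by (subst (asm) AE_distr_iff) auto
  have lim: "(\<lambda>n. u n z) \<longlonglongrightarrow> real_of_ereal (f (fst z)) + real_of_ereal (g (snd z))"
    if "\<bar>f (fst z)\<bar> \<noteq> \<infinity>" "\<bar>g (snd z)\<bar> \<noteq> \<infinity>" for z
    unfolding u_def by (intro tendsto_add tendsto_clip that)
  \<comment> \<open>Under \<open>\<pi>'\<close> the sum equals \<open>k\<close>, which is
    nonnegative; clipping keeps it nonnegative, so \<open>0 \<le> u n z \<le> k z\<close> and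
    \<open>k\<close> dominates the difference.\<close>
  have "(\<lambda>n. integral\<^sup>L \<pi>' (\<lambda>z. k z - u n z)) \<longlonglongrightarrow> integral\<^sup>L \<pi>' (\<lambda>z. 0)"
  proof (rule integral_dominated_convergence[where w=k])
    show "AE z in \<pi>'. (\<lambda>n. k z - u n z) \<longlonglongrightarrow> 0"
      using AE' fing
    proof eventually_elim
      case (elim z)
      then have "real_of_ereal (f (fst z)) + real_of_ereal (g (snd z)) = k z"
        by (cases "f (fst z)"; cases "g (snd z)") auto
      then show ?case using tendsto_diff[OF tendsto_const[of "k z"] lim[of z]] elim by auto
    qed
    show "AE z in \<pi>'. norm (k z - u n z) \<le> k z" for n
      using AE'
    proof eventually_elim
      case (elim z)
      then have "0 \<le> u n z" unfolding u_def using k0[of z]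
        by (cases "f (fst z)"; cases "g (snd z)") auto
      then show ?case using ule[of n z] by simp
    qed
  qed (use intk km meas[OF \<pi>'] in auto)
  \<comment> \<open>The integral of \<open>u n\<close> is determined by the marginals, and that of
    \<open>k\<close> agrees by assumption.\<close>
  moreover have "integral\<^sup>L \<pi>' (\<lambda>z. k z - u n z) = integral\<^sup>L \<pi> (\<lambda>z. k z - u n z)" for n
    using intk intu[OF \<pi>] intu[OF \<pi>'] uval[OF \<pi>] uval[OF \<pi>'] kk by simp
  ultimately have L: "(\<lambda>n. integral\<^sup>L \<pi> (\<lambda>z. k z - u n z)) \<longlonglongrightarrow> 0" by simp
  define v where "v = (\<lambda>z. k z - (real_of_ereal (f (fst z)) + real_of_ereal (g (snd z))))"
  have vm: "v \<in> borel_measurable \<pi>"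
    unfolding v_def using p km f g by measurable
  have conv: "AE z in \<pi>. (\<lambda>n. k z - u n z) \<longlonglongrightarrow> v z"
    using f1 g1
  proof eventually_elim
    case (elim z)
    then show ?case unfolding v_def by (intro tendsto_diff tendsto_const lim)
  qed
  \<comment> \<open>Under \<open>\<pi>\<close> the sums \<open>u n\<close> have no lower bound
    independent of \<open>n\<close>, but \<open>k - u n\<close> is nonnegative, so Fatou's lemma
    takes the place of dominated convergence.\<close>
  have "(\<integral>\<^sup>+z. ennreal (v z) \<partial>\<pi>) = (\<integral>\<^sup>+z. liminf (\<lambda>n. ennreal (k z - u n z)) \<partial>\<pi>)"
  proof (rule nn_integral_cong_AE)
    show "AE z in \<pi>. ennreal (v z) = liminf (\<lambda>n. ennreal (k z - u n z))"
      using conv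
    proof eventually_elim
      case (elim z)
      then have "(\<lambda>n. ennreal (k z - u n z)) \<longlonglongrightarrow> ennreal (v z)" by (rule tendsto_ennrealI)
      then show ?case by (metis lim_imp_Liminf sequentially_bot)
    qed
  qed
  also have "\<dots> \<le> liminf (\<lambda>n. \<integral>\<^sup>+z. ennreal (k z - u n z) \<partial>\<pi>)"
    using km meas[OF \<pi>] by (intro nn_integral_liminf) auto
  also have "\<dots> = liminf (\<lambda>n. ennreal (integral\<^sup>L \<pi> (\<lambda>z. k z - u n z)))"
    using intk intu[OF \<pi>] ule by (subst nn_integral_eq_integral) auto
  also have "\<dots> = 0"
    using tendsto_ennrealI[OF L] by (metis lim_imp_Liminf sequentially_bot ennreal_0)
  finally have "(\<integral>\<^sup>+z. ennreal (v z) \<partial>\<pi>) = 0" by simp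
  then have "AE z in \<pi>. ennreal (v z) = 0"
    using vm by (subst (asm) nn_integral_0_iff_AE) auto
  then show ?thesis using f1 g1
  proof eventually_elim
    case (elim z)
    then show ?case using le[of "fst z" "snd z"] 
      by (cases "f (fst z)"; cases "g (snd z)") (auto simp: v_def ennreal_eq_0_iff)
  qed
qed

text \<open>The definition of a potential gives equality almost everywhere for some optimal plan
  \<open>\<pi>'\<close>, and the two plans share marginals and cost, so it holds for
  \<open>\<pi>\<close> too. The set \<open>Q\<close> where it fails is open by semicontinuity, and
  an open null set misses the support.\<close>

lemma supp_subset_contact_set:
  fixes \<mu> :: "'a::second_countable_topology measure" and \<nu> :: "'b::second_countable_topology measure"
  assumes c0: "\<And>z. 0 \<le> c z" and cont: "continuous_on UNIV c"
    and fin: "transport_cost c \<mu> \<nu> < \<infinity>"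
    and \<pi>: "\<pi> \<in> optimal_plans c \<mu> \<nu>"
    and f: "f \<in> kantorovich_potentials c \<mu> \<nu>"
    and xy: "(x, y) \<in> supp \<pi>"
  shows "f x + ctransform_X c f y = ereal (c (x, y))"
proof -
  obtain g x0 \<pi>' where fi: "\<And>x. f x \<noteq> \<infinity>" and x0: "f x0 \<noteq> - \<infinity>"
    and fg: "f = ctransform_Y c g"
    and \<pi>': "\<pi>' \<in> optimal_plans c \<mu> \<nu>"
    and eq': "ereal_integral \<pi>' (\<lambda>(x, y). f x + ctransform_X c f y) = enn2ereal (transport_cost c \<mu> \<nu>)"
    using f by (auto simp: kantorovich_potentials_def c_concave_def)
  define k where "k = ctransform_X c f"
  have le: "k y \<noteq> \<infinity>" "f x + k y \<le> ereal (c (x, y))" for x y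
    using add_ctransform_X_le[of f x x0 c y] fi x0 by (auto simp: k_def)
  have of: "open {x. f x < a}" for a
    unfolding fg ctransform_Y_def
    by (intro open_INF_diff_less continuous_on_compose2[OF cont] continuous_intros) auto
  have ok: "open {y. k y < a}" for a
    unfolding k_def ctransform_X_def
    by (rule open_INF_diff_less[where k="\<lambda>y x. c (x, y)"],
        intro continuous_on_compose2[OF cont] continuous_intros) auto
  have fm: "f \<in> borel_measurable borel" using of by (intro borel_measurableI_less) auto
  have km: "k \<in> borel_measurable borel" using ok by (intro borel_measurableI_less) auto
  have cm: "c \<in> borel_measurable borel" using cont by (rule borel_measurable_continuous_onI)
  have C: "\<pi> \<in> couplings \<mu> \<nu>" "\<pi>' \<in> couplings \<mu> \<nu>"
    and T: "(\<integral>\<^sup>+z. ennreal (c z) \<partial>\<pi>) = transport_cost c \<mu> \<nu>"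
      "(\<integral>\<^sup>+z. ennreal (c z) \<partial>\<pi>') = transport_cost c \<mu> \<nu>"
    using \<pi> \<pi>' by (auto simp: optimal_plans_def)
  note p = couplingsD[OF C(1)] and p' = couplingsD[OF C(2)]
  have Hm: "(\<lambda>z. f (fst z) + k (snd z)) \<in> borel_measurable \<pi>'"
    using p'(4,5) fm km by measurable
  have AE': "AE z in \<pi>'. f (fst z) + k (snd z) = ereal (c z)"
  proof (rule ereal_integral_eqD[OF Hm])
    show "c \<in> borel_measurable \<pi>'" using cm p'(2) by (auto cong: measurable_cong_sets)
    show "f (fst z) + k (snd z) \<le> ereal (c z)" for z using le(2)[of "fst z" "snd z"] by simp
    show "ereal_integral \<pi>' (\<lambda>z. f (fst z) + k (snd z)) = enn2ereal (\<integral>\<^sup>+z. ennreal (c z) \<partial>\<pi>')"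
      using eq' T by (simp add: k_def case_prod_unfold)
  qed (use c0 T fin in auto)
  have AE: "AE z in \<pi>. f (fst z) + k (snd z) = ereal (c z)"
    by (rule AE_equality_couplings[OF C cm c0 _ _ fm km le(2) AE']) (use T fin in auto)
  define Q where "Q = {z. f (fst z) + k (snd z) < ereal (c z)}"
  \<comment> \<open>Real bounds \<open>\<alpha>\<close> and \<open>\<beta>\<close> squeezed between
    the two sides display \<open>Q\<close> as a union of open sets, including the points where
    \<open>f\<close> or its transform is \<open>- \<infinity>\<close>.\<close>
  have "Q = (\<Union>\<alpha>. \<Union>\<beta>. ({x. f x < ereal \<alpha>} \<times> {y. k y < ereal \<beta>}) \<inter> {z. \<alpha> + \<beta> < c z})"
  proof safe
    fix x y assume "(x, y) \<in> Q"
    then have lt: "f x + k y < ereal (c (x, y))" by (simp add: Q_def)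
    have "\<exists>\<alpha> \<beta>. f x < ereal \<alpha> \<and> k y < ereal \<beta> \<and> \<alpha> + \<beta> < c (x, y)"
    proof (cases "f x"; cases "k y")
      \<comment> \<open>Each summand gets a third of the gap, and the last third keeps the
        inequality strict.\<close>
      fix r s assume "f x = ereal r" "k y = ereal s"
      then show ?thesis using lt
        by - (rule exI[of _ "r + (c (x, y) - r - s) / 3"], rule exI[of _ "s + (c (x, y) - r - s) / 3"], auto simp: field_simps)
    next
      fix r assume "f x = ereal r" "k y = - \<infinity>"
      then show ?thesis
        by - (rule exI[of _ "r + 1"], rule exI[of _ "c (x, y) - r - 2"], auto simp: field_simps)
    next
      fix r assume "f x = - \<infinity>" "k y = ereal r" 
      then show ?thesis
        by - (rule exI[of _ "c (x, y) - r - 2"], rule exI[of _ "r + 1"], auto simp: field_simps)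
    next
      assume "f x = - \<infinity>" "k y = - \<infinity>" 
      then show ?thesis
        by - (rule exI[of _ "c (x, y) - 1"], rule exI[of _ "0"], auto simp: field_simps)
    qed (use fi le in auto)
    then show "(x, y) \<in> (\<Union>\<alpha>. \<Union>\<beta>. ({x. f x < ereal \<alpha>} \<times> {y. k y < ereal \<beta>}) \<inter> {z. \<alpha> + \<beta> < c z})"
      by auto
  next
    fix x y \<alpha> \<beta> assume "f x < ereal \<alpha>" "k y < ereal \<beta>" "\<alpha> + \<beta> < c (x, y)"
    then show "(x, y) \<in> Q" by (cases "f x"; cases "k y") (auto simp: Q_def)
  qed
  moreover have "open {z. \<alpha> + \<beta> < c z}" for \<alpha> \<beta>
    using cont by (intro open_Collect_less) auto
  ultimately have "open Q" by (auto intro!: open_Int open_Times of ok)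
  moreover have "emeasure \<pi> Q = 0"
  proof -
    have "AE z in \<pi>. z \<notin> Q" using AE by eventually_elim (auto simp: Q_def)
    then show ?thesis using \<open>open Q\<close> p by (subst (asm) AE_iff_measurable[of Q]) (auto simp: p(2))
  qed
  ultimately have "supp \<pi> \<subseteq> - Q" by (intro supp_subset) auto
  then show ?thesis using xy le(2)[of x y] by (auto simp: Q_def k_def)
qed

section \<open>Local constancy of the difference in a chart\<close>

text \<open>A ball in the chart image is convex, so \<open>x\<close> is joined to each nearby point
  by a straight segment. Contact with the functions \<open>k y\<close> from above gives
  \<open>f1\<close> and \<open>f2\<close> both the Lipschitz constant \<open>L\<close> and, along
  the segment, a common supergradient.\<close>

lemma locally_constant_diff_chart:
  fixes \<phi> :: "'a::topological_space \<Rightarrow> 'e::real_inner" and k :: "'b \<Rightarrow> 'a \<Rightarrow> real"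
  assumes chart: "is_chart (U, \<phi>)" and xU: "x \<in> U"
    and diff: "\<And>y x. x \<in> U \<Longrightarrow> (k y \<circ> inv_into U \<phi>) differentiable (at (\<phi> x))"
    and W: "open W" "x \<in> W" "W \<subseteq> U"
    and lip: "\<And>y. y \<in> K \<Longrightarrow> L-lipschitz_on (\<phi> ` W) (k y \<circ> inv_into U \<phi>)"
    and touch: "\<And>u. u \<in> W \<Longrightarrow> \<exists>y\<in>K. \<forall>v\<in>W. f1 v - f1 u \<le> k y v - k y u \<and> f2 v - f2 u \<le> k y v - k y u"
  obtains V where "open V" "x \<in> V" "V \<subseteq> W" "\<And>v. v \<in> V \<Longrightarrow> f1 v - f2 v = f1 x - f2 x"
proof -
  define \<psi> where "\<psi> = inv_into U \<phi>"
  have hom: "homeomorphism U (\<phi> ` U) \<phi> \<psi>" and oU: "open U" "open (\<phi> ` U)"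
    using chart by (auto simp: is_chart_def \<psi>_def)
  have \<psi>\<phi>: "\<psi> (\<phi> u) = u" if "u \<in> U" for u
    using homeomorphism_apply1[OF hom that] .
  have "openin (top_of_set (\<phi> ` U)) (\<phi> ` W)"
    using homeomorphism_imp_open_map[OF hom, of W] W(1,3) by (simp add: open_openin_trans open_subset oU)
  then have "open (\<phi> ` W)" using oU(2) openin_open_trans by blast
  then obtain r where r: "r > 0" "ball (\<phi> x) r \<subseteq> \<phi> ` W"
    using W(2) by (meson imageI open_contains_ball)
  define B where "B = ball (\<phi> x) r"
  have BW: "\<psi> z \<in> W" "\<phi> (\<psi> z) = z" if "z \<in> B" for z
  proof -
    obtain u where "u \<in> W" "z = \<phi> u" using \<open>z \<in> B\<close> r(2) by (auto simp: B_def)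
    then show "\<psi> z \<in> W" "\<phi> (\<psi> z) = z" using \<psi>\<phi>[of u] W(3) by auto
  qed
  define V where "V = U \<inter> \<phi> -` B"
  have "open V" unfolding V_def
    using homeomorphism_cont1[OF hom] oU by (intro continuous_open_preimage) (auto simp: B_def)
  moreover have "x \<in> V" using xU r by (simp add: V_def B_def)
  moreover have "V \<subseteq> W" using BW(1) \<psi>\<phi> by (fastforce simp: V_def)
  moreover have "f1 v - f2 v = f1 x - f2 x" if v: "v \<in> V" for v
  proof -
    define w where "w = (\<lambda>t::real. \<phi> x + t *\<^sub>R (\<phi> v - \<phi> x))"
    have wB: "w t \<in> B" if "t \<in> {0..1}" for t
    proof -
      have "norm (t *\<^sub>R (\<phi> v - \<phi> x)) \<le> norm (\<phi> v - \<phi> x)"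
        using that by (simp add: mult_left_le_one_le)
      also have "\<dots> < r" using v by (simp add: V_def B_def dist_norm norm_minus_commute)
      finally show ?thesis by (simp add: w_def B_def dist_norm)
    qed
    have "L \<ge> 0" using touch[OF W(2)] lip lipschitz_on_nonneg by blast
    have cont: "continuous_on {0..1} (\<lambda>t. f (\<psi> (w t)))"
      if f: "\<And>u. u \<in> W \<Longrightarrow> \<exists>y\<in>K. \<forall>v\<in>W. f v - f u \<le> k y v - k y u" for f
    proof -
      \<comment> \<open>Contact at \<open>b\<close> bounds the increment from one side; exchanging
        \<open>a\<close> and \<open>b\<close> bounds the other. The constant is the same for all
        points because \<open>L\<close> serves every \<open>y\<close> in \<open>K\<close>.\<close>
      have *: "f (\<psi> a) - f (\<psi> b) \<le> L * dist a b" if ab: "a \<in> B" "b \<in> B" for a b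
      proof -
        obtain y where y: "y \<in> K" "f (\<psi> a) - f (\<psi> b) \<le> k y (\<psi> a) - k y (\<psi> b)"
          using f[OF BW(1)[OF ab(2)]] BW(1)[OF ab(1)] by auto
        have "dist (k y (\<psi> a)) (k y (\<psi> b)) \<le> L * dist a b"
          using lipschitz_onD[OF lip[OF y(1)], of a b] ab r(2) by (simp add: \<psi>_def B_def subset_iff)
        then show ?thesis using y(2) by (simp add: dist_real_def)
      qed
      have "L-lipschitz_on B (\<lambda>z. f (\<psi> z))"
      proof (rule lipschitz_onI)
        fix a b assume "a \<in> B" "b \<in> B"
        then show "dist (f (\<psi> a)) (f (\<psi> b)) \<le> L * dist a b"
          using *[of a b] *[of b a] by (simp add: dist_real_def dist_commute)
      qed fact
      then have "continuous_on B (\<lambda>z. f (\<psi> z))" by (rule lipschitz_on_continuous_on)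
      then show ?thesis
        by (rule continuous_on_compose2) (use wB in \<open>auto simp: w_def intro!: continuous_intros\<close>)
    qed
    have c1: "continuous_on {0..1} (\<lambda>t. f1 (\<psi> (w t)))"
      by (rule cont) (use touch in blast)
    have c2: "continuous_on {0..1} (\<lambda>t. f2 (\<psi> (w t)))"
      by (rule cont) (use touch in blast)
    have super: "\<exists>p. \<forall>e>0. \<exists>d>0. \<forall>s. \<bar>s - t\<bar> < d \<longrightarrow>
        f1 (\<psi> (w s)) - f1 (\<psi> (w t)) \<le> p * (s - t) + e * \<bar>s - t\<bar> \<and>
        f2 (\<psi> (w s)) - f2 (\<psi> (w t)) \<le> p * (s - t) + e * \<bar>s - t\<bar>" if t: "t \<in> {0<..<1}" for t
    proof -
      have wt: "w t \<in> B" using wB t by auto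
      obtain y where y: "\<forall>v\<in>W. f1 v - f1 (\<psi> (w t)) \<le> k y v - k y (\<psi> (w t)) \<and>
          f2 v - f2 (\<psi> (w t)) \<le> k y v - k y (\<psi> (w t))"
        using touch[OF BW(1)[OF wt]] by blast
      have "(k y \<circ> \<psi>) differentiable (at (w t))"
        using diff[of "\<psi> (w t)" y] BW[OF wt] W(3) by (auto simp: \<psi>_def)
      moreover have "w differentiable (at t)"
        unfolding w_def by (intro derivative_intros)
      ultimately have "((k y \<circ> \<psi>) \<circ> w) differentiable (at t)"
        by (rule differentiable_chain_at[rotated])
      \<comment> \<open>The derivative of \<open>k y\<close> along the segment; the same
        \<open>y\<close> touches both functions, so \<open>p\<close> serves both.\<close>
      then obtain p where p: "((\<lambda>s. k y (\<psi> (w s))) has_derivative (*) p) (at t)"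
        by (auto simp: real_differentiable_def has_field_derivative_def comp_def)
      show ?thesis
      proof (rule exI[of _ p], intro allI impI)
        fix e :: real assume "e > 0"
        then obtain d where d: "d > 0" "\<And>s. norm (s - t) < d \<Longrightarrow>
            norm (k y (\<psi> (w s)) - k y (\<psi> (w t)) - p * (s - t)) \<le> e * norm (s - t)"
          using p unfolding has_derivative_at_alt by blast
        show "\<exists>d>0. \<forall>s. \<bar>s - t\<bar> < d \<longrightarrow>
          f1 (\<psi> (w s)) - f1 (\<psi> (w t)) \<le> p * (s - t) + e * \<bar>s - t\<bar> \<and>
          f2 (\<psi> (w s)) - f2 (\<psi> (w t)) \<le> p * (s - t) + e * \<bar>s - t\<bar>"
        \<comment> \<open>The radius \<open>min t (1 - t)\<close> keeps \<open>s\<close> in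
          \<open>{0..1}\<close>, hence the point in \<open>W\<close>, where the contact inequality
          holds.\<close>
        proof (intro exI[of _ "min d (min t (1 - t))"] conjI allI impI)
          show "0 < min d (min t (1 - t))" using d t by auto
          fix s assume s: "\<bar>s - t\<bar> < min d (min t (1 - t))"
          then have "s \<in> {0..1}" by auto
          then have "\<psi> (w s) \<in> W" using wB BW by blast
          then show "f1 (\<psi> (w s)) - f1 (\<psi> (w t)) \<le> p * (s - t) + e * \<bar>s - t\<bar>"
            "f2 (\<psi> (w s)) - f2 (\<psi> (w t)) \<le> p * (s - t) + e * \<bar>s - t\<bar>"
            using y d(2)[of s] s by (force simp: abs_le_iff)+
        qed
      qed
    qed
    \<comment> \<open>The supergradient condition is symmetric in \<open>f1\<close> and
      \<open>f2\<close>, so the one-sided comparison applies both ways.\<close>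
    have "f1 (\<psi> (w 0)) - f2 (\<psi> (w 0)) \<le> f1 (\<psi> (w 1)) - f2 (\<psi> (w 1))"
      by (rule diff_le_of_common_supergradient[OF _ c1 c2 super]) auto
    moreover have "f2 (\<psi> (w 0)) - f1 (\<psi> (w 0)) \<le> f2 (\<psi> (w 1)) - f1 (\<psi> (w 1))"
      by (rule diff_le_of_common_supergradient[OF _ c2 c1]) (use super in \<open>simp_all add: conj_commute\<close>)
    moreover have "\<psi> (w 0) = x" "\<psi> (w 1) = v"
      using \<psi>\<phi> xU v by (auto simp: w_def V_def)
    ultimately show ?thesis by simp
  qed
  ultimately show thesis by (rule that)
qed

section \<open>Contact partners at interior points\<close>

text \<open>Regularity supplies partners in \<open>K\<close> only for points of \<open>U\<close> in
  the projection of \<open>supp \<pi>\<close>, which are merely dense. The part \<open>D\<close> of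
  the projection with partners in \<open>K\<close> is closed by compactness of \<open>K\<close>,
  hence contains all of \<open>W\<close>.\<close>

lemma regular_interior_point:
  fixes \<mu> :: "'a::polish_space measure" and \<nu> :: "'b::polish_space measure"
  assumes \<pi>: "\<pi> \<in> couplings \<mu> \<nu>" and x: "x \<in> interior (supp \<mu>)"
    and reg: "induces_regularity_at \<mu> \<nu> \<pi> x"
  obtains W K where "open W" "x \<in> W" "W \<subseteq> supp \<mu>" "compact K"
    "\<And>u. u \<in> W \<Longrightarrow> \<exists>y\<in>K. (u, y) \<in> supp \<pi>"
proof -
  obtain U K where U: "x \<in> U" "openin (top_of_set (supp \<mu>)) U" and K: "compact K"
    and eq: "fst ` supp \<pi> \<inter> U = fst ` (supp \<pi> \<inter> (U \<times> K))"
    using reg by (auto simp: induces_regularity_at_def induces_regularity_on_def)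
  obtain O' where O: "open O'" "U = supp \<mu> \<inter> O'" using U(2) by (auto simp: openin_open)
  \<comment> \<open>Intersecting with the interior turns the relatively open \<open>U\<close> into
    an open set of the whole space.\<close>
  define W where "W = interior (supp \<mu>) \<inter> O'"
  have W: "open W" "x \<in> W" "W \<subseteq> U" "W \<subseteq> supp \<mu>"
    using O U x interior_subset by (auto simp: W_def)
  define D where "D = fst ` (supp \<pi> \<inter> (UNIV \<times> K))"
  have "closed D"
    unfolding closed_sequential_limits
  proof (intro allI impI, elim conjE)
    fix u l assume u: "\<forall>n. u n \<in> D" and l: "u \<longlonglongrightarrow> l"
    then have "\<forall>n. \<exists>y. y \<in> K \<and> (u n, y) \<in> supp \<pi>" by (fastforce simp: D_def)
    then obtain v where v: "\<And>n. v n \<in> K" "\<And>n. (u n, v n) \<in> supp \<pi>" by metis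
    then obtain y r where y: "y \<in> K" "strict_mono r" "(v \<circ> r) \<longlonglongrightarrow> y"
      using K unfolding compact_def by metis
    have "(\<lambda>n. ((u \<circ> r) n, (v \<circ> r) n)) \<longlonglongrightarrow> (l, y)"
      using LIMSEQ_subseq_LIMSEQ[OF l y(2)] y(3) by (rule tendsto_Pair)
    then have "(l, y) \<in> supp \<pi>"
      by (rule closed_sequentially[OF closed_supp, rotated]) (simp add: v)
    then show "l \<in> D" using y(1) by (force simp: D_def)
  qed
  have "W \<subseteq> D"
  proof
    fix u assume u: "u \<in> W"
    show "u \<in> D"
    proof (rule ccontr)
      assume "u \<notin> D"
      \<comment> \<open>The open set \<open>W - D\<close> would meet the projection of
        \<open>supp \<pi>\<close>, but regularity puts that projected point into
        \<open>D\<close>.\<close>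
      then obtain z where z: "z \<in> supp \<pi>" "fst z \<in> W - D"
        using supp_coupling_meets[OF \<pi>, of "W - D" u] W u \<open>closed D\<close>
        by (metis DiffI open_Diff subsetD)
      then have "fst z \<in> fst ` (supp \<pi> \<inter> (U \<times> K))" using eq W by blast
      then show False using z(2) by (auto simp: D_def)
    qed
  qed
  then have "\<exists>y\<in>K. (u, y) \<in> supp \<pi>" if "u \<in> W" for u
    using that by (force simp: D_def)
  then show thesis using that[of W K] W K by blast
qed

section \<open>Uniqueness of the potentials\<close>

theorem corollary4:
  fixes \<A> :: "('a::polish_space, 'e::real_inner) chart set"
    and \<mu> :: "'a measure" and \<nu> :: "'b::polish_space measure"
    and c :: "'a \<times> 'b \<Rightarrow> real"
    and \<pi> :: "('a \<times> 'b) measure"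
  assumes "smooth_atlas \<A>"
    and "\<mu> \<in> borel_probs" and "\<nu> \<in> borel_probs"
    and "\<And>z. 0 \<le> c z"
    and "continuous_on UNIV c"
    and "\<And>y. differentiable_in_charts \<A> (\<lambda>x. c (x, y))"
    and "locally_lipschitz_locally_uniformly \<A> (\<lambda>y x. c (x, y))"
    and "transport_cost c \<mu> \<nu> < \<infinity>"
    and "\<pi> \<in> optimal_plans c \<mu> \<nu>"
    and "irregular_points \<mu> \<nu> \<pi> \<subseteq> frontier (supp \<mu>)"
    and "connected (interior (supp \<mu>))"
    and "closure (interior (supp \<mu>)) = supp \<mu>"
    and "measure \<mu> (interior (supp \<mu>)) = 1"
  shows "unique_potentials c \<mu> \<nu>"
proof -
  define M where "M = interior (supp \<mu>)"
  have \<pi>: "\<pi> \<in> couplings \<mu> \<nu>" using assms(9) by (simp add: optimal_plans_def)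
  have near: "\<exists>W K. open W \<and> x \<in> W \<and> W \<subseteq> supp \<mu> \<and> compact K \<and> (\<forall>u\<in>W. \<exists>y\<in>K. (u, y) \<in> supp \<pi>)"
    if x: "x \<in> M" for x
  proof -
    have "x \<notin> frontier (supp \<mu>)" "x \<in> supp \<mu>"
      using x interior_subset by (auto simp: M_def frontier_def)
    then have "induces_regularity_at \<mu> \<nu> \<pi> x"
      using assms(10) by (auto simp: irregular_points_def)
    then show ?thesis
      using regular_interior_point[OF \<pi> x[unfolded M_def]] by metis
  qed
  have "\<exists>a::real. AE x in \<mu>. f1 x - f2 x = ereal a"
    if f1: "f1 \<in> kantorovich_potentials c \<mu> \<nu>" and f2: "f2 \<in> kantorovich_potentials c \<mu> \<nu>" for f1 f2
  proof -
    \<comment> \<open>\<open>real_of_ereal\<close> sends infinite values to 0, but both potentials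
      are finite on \<open>M\<close>, where every point has a contact partner.\<close>
    define h where "h = (\<lambda>x. real_of_ereal (f1 x) - real_of_ereal (f2 x))"
    \<comment> \<open>The function \<open>c(\<cdot>, y) - f\<^sup>c(y)\<close>, written
      \<open>c (u, y) - ctransform_X c f y\<close>, lies above \<open>f\<close> and meets it at
      \<open>x\<close>; subtracting the equality at \<open>x\<close> removes the transform.\<close>
    have contact: "\<bar>f x\<bar> \<noteq> \<infinity>"
      "\<bar>f u\<bar> \<noteq> \<infinity> \<Longrightarrow> real_of_ereal (f u) - real_of_ereal (f x) \<le> c (u, y) - c (x, y)"
      if f: "f \<in> kantorovich_potentials c \<mu> \<nu>" and xy: "(x, y) \<in> supp \<pi>" for f x y u
    proof -
      have eq: "f x + ctransform_X c f y = ereal (c (x, y))"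
        by (rule supp_subset_contact_set[OF assms(4,5,8,9) f xy])
      then show fin: "\<bar>f x\<bar> \<noteq> \<infinity>" by (cases "f x"; cases "ctransform_X c f y") auto
      assume "\<bar>f u\<bar> \<noteq> \<infinity>"
      then have "f u + ctransform_X c f y \<le> ereal (c (u, y))"
        using add_ctransform_X_le(2)[of f u u c y] by auto
      then show "real_of_ereal (f u) - real_of_ereal (f x) \<le> c (u, y) - c (x, y)"
        using eq fin \<open>\<bar>f u\<bar> \<noteq> \<infinity>\<close>
        by (cases "f x"; cases "f u"; cases "ctransform_X c f y") auto
    qed
    have loc: "\<exists>V. open V \<and> x \<in> V \<and> (\<forall>v\<in>V. h v = h x)" if x: "x \<in> M" for x
    proof -
      obtain W K where W: "open W" "x \<in> W" "W \<subseteq> supp \<mu>" and K: "compact K"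
        and WK: "\<And>u. u \<in> W \<Longrightarrow> \<exists>y\<in>K. (u, y) \<in> supp \<pi>"
        using near[OF x] by blast
      have "x \<in> (\<Union>(U, \<phi>)\<in>\<A>. U)" using assms(1) by (simp add: smooth_atlas_def)
      then obtain U \<phi> where C: "(U, \<phi>) \<in> \<A>" "x \<in> U" by auto
      have ch: "is_chart (U, \<phi>)" using assms(1) C by (auto simp: smooth_atlas_def)
      \<comment> \<open>Compactness of \<open>K\<close> enters here: one neighbourhood and one
        constant serve all contact partners near \<open>x\<close>.\<close>
      have "locally_lipschitz_uniformly \<A> K (\<lambda>y x. c (x, y))"
        using assms(7) K by (auto simp: locally_lipschitz_locally_uniformly_def)
      then obtain N L where N: "open N" "x \<in> N" "N \<subseteq> U"
        and L: "\<And>y. y \<in> K \<Longrightarrow> L-lipschitz_on (\<phi> ` N) ((\<lambda>x. c (x, y)) \<circ> inv_into U \<phi>)"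
        unfolding locally_lipschitz_uniformly_def using C by fast
      have fin: "\<bar>f1 u\<bar> \<noteq> \<infinity>" "\<bar>f2 u\<bar> \<noteq> \<infinity>" if u: "u \<in> W" for u
      proof -
        obtain y where y: "(u, y) \<in> supp \<pi>" using WK[OF u] by blast
        show "\<bar>f1 u\<bar> \<noteq> \<infinity>" "\<bar>f2 u\<bar> \<noteq> \<infinity>"
          by (rule contact(1)[OF f1 y], rule contact(1)[OF f2 y])
      qed
      show ?thesis
      proof (rule locally_constant_diff_chart[OF ch C(2), where k="\<lambda>y x. c (x, y)" and W="W \<inter> N"
            and K=K and L=L and ?f1.0="\<lambda>x. real_of_ereal (f1 x)" and ?f2.0="\<lambda>x. real_of_ereal (f2 x)"])
        show "((\<lambda>x. c (x, y)) \<circ> inv_into U \<phi>) differentiable (at (\<phi> u))" if "u \<in> U" for y u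
          using assms(6)[of y] C(1) that unfolding differentiable_in_charts_def by fast
        show "L-lipschitz_on (\<phi> ` (W \<inter> N)) ((\<lambda>x. c (x, y)) \<circ> inv_into U \<phi>)" if "y \<in> K" for y
          using L[OF that] by (rule lipschitz_on_subset) auto
        show "\<exists>y\<in>K. \<forall>v\<in>W \<inter> N.
            real_of_ereal (f1 v) - real_of_ereal (f1 u) \<le> c (v, y) - c (u, y) \<and>
            real_of_ereal (f2 v) - real_of_ereal (f2 u) \<le> c (v, y) - c (u, y)" if "u \<in> W \<inter> N" for u
        proof -
          obtain y where "y \<in> K" and y: "(u, y) \<in> supp \<pi>" using WK \<open>u \<in> W \<inter> N\<close> by blast
          moreover have "real_of_ereal (f1 v) - real_of_ereal (f1 u) \<le> c (v, y) - c (u, y)"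
            "real_of_ereal (f2 v) - real_of_ereal (f2 u) \<le> c (v, y) - c (u, y)" if "v \<in> W" for v
            using contact(2)[OF f1 y fin(1)] contact(2)[OF f2 y fin(2)] that by simp_all
          ultimately show ?thesis by blast
        qed
        show "\<exists>V. open V \<and> x \<in> V \<and> (\<forall>v\<in>V. h v = h x)"
          if "open V" "x \<in> V"
            "\<And>v. v \<in> V \<Longrightarrow> real_of_ereal (f1 v) - real_of_ereal (f2 v) = real_of_ereal (f1 x) - real_of_ereal (f2 x)"
          for V
          unfolding h_def using that by blast
      qed (use W N in blast)+
    qed
    \<comment> \<open>Full measure makes \<open>M\<close> nonempty and so provides the base point
      whose value of \<open>h\<close> is the constant.\<close>
    have "measure \<mu> M = 1" using assms(13) by (simp only: M_def)
    then have "M \<noteq> {}" by (metis measure_empty zero_neq_one)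
    then obtain x0 where x0: "x0 \<in> M" by blast
    have const: "h x = h x0" if "x \<in> M" for x
    proof (rule connected_local_const[of M x x0 h])
      show "\<forall>x\<in>M. eventually (\<lambda>y. h x = h y) (at x within M)"
      proof
        fix x assume "x \<in> M"
        then obtain V where "open V" "x \<in> V" "\<forall>v\<in>V. h v = h x" using loc by blast
        then show "eventually (\<lambda>y. h x = h y) (at x within M)"
          unfolding eventually_at_topological by metis
      qed
    qed (use that x0 assms(11) in \<open>auto simp: M_def\<close>)
    interpret prob_space \<mu> using assms(2) by (simp add: borel_probs_def)
    have "AE x in \<mu>. x \<in> M"
      using assms(2,13) by (intro AE_prob_1) (auto simp: M_def)
    then have "AE x in \<mu>. f1 x - f2 x = ereal (h x0)"
    proof eventually_elim
      case (elim x)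
      then obtain y where y: "(x, y) \<in> supp \<pi>" using near by blast
      have "\<bar>f1 x\<bar> \<noteq> \<infinity>" "\<bar>f2 x\<bar> \<noteq> \<infinity>" using contact(1)[OF f1 y] contact(1)[OF f2 y] by auto
      then have "f1 x - f2 x = ereal (h x)" by (cases "f1 x"; cases "f2 x") (auto simp: h_def)
      then show ?case using const[OF elim] by simp
    qed
    then show ?thesis by blast
  qed
  then show ?thesis by (simp add: unique_potentials_def)
qed

end
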